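(* Let $P$ be a (loopless) polymatroid on $E=\{1,\dots,n\}$. For $1\le i\le n$ let $\widetilde E_i=\{1,\dots,\mathrm{rk}_P(i)\}$ (taken as disjoint sets), $\widetilde E=\widetilde E_1\sqcup\cdots\sqcup\widetilde E_n$, and $\pi:\widetilde E\to E$ with $\pi^{-1}(i)=\widetilde E_i$. Then the matroid $\widetilde P$ on $\widetilde E$ with rank function $\mathrm{rk}_{\widetilde P}(S)=\min\{\mathrm{rk}_P(A)+|S\setminus\pi^{-1}(A)|: A\subseteq E\}$, with the partition $\widetilde E=\widetilde E_1\sqcup\cdots\sqcup\widetilde E_n$, is a minimal multisymmetric lift of $P$, and it is the unique minimal multisymmetric lift of $P$ (up to isomorphism).
   Context: A polymatroid on a finite set $E$ is a function $\mathrm{rk}:2^E\to\mathbb Z_{\ge0}$ that is submodular, monotone, with $\mathrm{rk}(\emptyset)=0$; all polymatroids (and matroids) are assumed loopless: $\mathrm{rk}(A)>0$ for nonempty $A$. A matroid is a polymatroid with $\mathrm{rk}(A)\le|A|$. A flat is a subset maximal among subsets of its rank. A multisymmetric matroid is a loopless matroid $M$ on $\widetilde E$ with a partition $\widetilde E=\widetilde E_1\sqcup\cdots\sqcup\widetilde E_n$ into nonempty blocks such that the group $\Gamma=\mathfrak S_{\widetilde E_1}\times\cdots\times\mathfrak S_{\widetilde E_n}$ acting on $\widetilde E$ maps flats of $M$ to flats of $M$. Such an $M$ is a multisymmetric lift of the polymatroid $P$ on $\{1,\dots,n\}$ if $\mathrm{rk}_P(A)=\mathrm{rk}_M(\bigcup_{i\in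 A}\widetilde E_i)$ for all $A$; it is a minimal multisymmetric lift if moreover $\mathrm{rk}_M(\widetilde E_i)=|\widetilde E_i|$ for all $i$. Isomorphism of multisymmetric lifts means a bijection of ground sets mapping each block $\widetilde E_i$ to the corresponding block and preserving rank. *)

theory Defs
  imports "HOL-Library.Disjoint_Sets" "HOL-Combinatorics.Permutations"
begin

text \<open>
  Ground sets are explicit carriers. The value of a rank function on a set that is not contained in
  the carrier is irrelevant, so it is never constrained.
\<close>

definition polymatroid :: "'a set \<Rightarrow> ('a set \<Rightarrow> nat) \<Rightarrow> bool" where
  "polymatroid E rk \<longleftrightarrow>
     finite E \<and>
     rk {} = 0 \<and>
     (\<forall>A B. A \<subseteq> B \<and> B \<subseteq> E \<longrightarrow> rk A \<le> rk B) \<and>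
     (\<forall>A B. A \<subseteq> E \<and> B \<subseteq> E \<longrightarrow> rk (A \<union> B) + rk (A \<inter> B) \<le> rk A + rk B)"

definition matroid :: "'a set \<Rightarrow> ('a set \<Rightarrow> nat) \<Rightarrow> bool" where
  "matroid E rk \<longleftrightarrow> polymatroid E rk \<and> (\<forall>A. A \<subseteq> E \<longrightarrow> rk A \<le> card A)"

definition loopless :: "'a set \<Rightarrow> ('a set \<Rightarrow> nat) \<Rightarrow> bool" where
  "loopless E rk \<longleftrightarrow> (\<forall>A. A \<subseteq> E \<and> A \<noteq> {} \<longrightarrow> rk A > 0)"

definition flat :: "'a set \<Rightarrow> ('a set \<Rightarrow> nat) \<Rightarrow> 'a set \<Rightarrow> bool" where
  "flat E rk F \<longleftrightarrow> F \<subseteq> E \<and> (\<forall>G. F \<subseteq> G \<and> G \<subseteq> E \<and> rk G = rk F \<longrightarrow> G = F)"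

text \<open>
  The product over \<open>i \<in> I\<close> of the symmetric groups of the blocks \<open>B i\<close>, as the group of those
  permutations of \<open>E\<close> that map each block onto itself.
\<close>

definition block_permutations :: "'a set \<Rightarrow> 'i set \<Rightarrow> ('i \<Rightarrow> 'a set) \<Rightarrow> ('a \<Rightarrow> 'a) set" where
  "block_permutations E I B = {\<sigma>. \<sigma> permutes E \<and> (\<forall>i\<in>I. \<sigma> ` B i = B i)}"

definition multisymmetric_matroid ::
    "'a set \<Rightarrow> ('a set \<Rightarrow> nat) \<Rightarrow> 'i set \<Rightarrow> ('i \<Rightarrow> 'a set) \<Rightarrow> bool" where
  "multisymmetric_matroid E rk I B \<longleftrightarrow>
     matroid E rk \<and> loopless E rk \<and>
     disjoint_family_on B I \<and> (\<Union>i\<in>I. B i) = E \<and> (\<forall>i\<in>I. B i \<noteq> {}) \<and>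
     (\<forall>\<sigma>\<in>block_permutations E I B. \<forall>F. flat E rk F \<longrightarrow> flat E rk (\<sigma> ` F))"

definition multisymmetric_lift ::
    "'i set \<Rightarrow> ('i set \<Rightarrow> nat) \<Rightarrow> 'a set \<Rightarrow> ('a set \<Rightarrow> nat) \<Rightarrow> ('i \<Rightarrow> 'a set) \<Rightarrow> bool" where
  "multisymmetric_lift I rkP E rk B \<longleftrightarrow>
     multisymmetric_matroid E rk I B \<and> (\<forall>A. A \<subseteq> I \<longrightarrow> rkP A = rk (\<Union>i\<in>A. B i))"

definition minimal_multisymmetric_lift ::
    "'i set \<Rightarrow> ('i set \<Rightarrow> nat) \<Rightarrow> 'a set \<Rightarrow> ('a set \<Rightarrow> nat) \<Rightarrow> ('i \<Rightarrow> 'a set) \<Rightarrow> bool" where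
  "minimal_multisymmetric_lift I rkP E rk B \<longleftrightarrow>
     multisymmetric_lift I rkP E rk B \<and> (\<forall>i\<in>I. rk (B i) = card (B i))"

definition lift_isomorphic ::
    "'i set \<Rightarrow> 'a set \<Rightarrow> ('a set \<Rightarrow> nat) \<Rightarrow> ('i \<Rightarrow> 'a set) \<Rightarrow>
     'b set \<Rightarrow> ('b set \<Rightarrow> nat) \<Rightarrow> ('i \<Rightarrow> 'b set) \<Rightarrow> bool" where
  "lift_isomorphic I E rk B E' rk' B' \<longleftrightarrow>
     (\<exists>\<phi>. bij_betw \<phi> E E' \<and> (\<forall>i\<in>I. \<phi> ` B i = B' i) \<and>
          (\<forall>S. S \<subseteq> E \<longrightarrow> rk' (\<phi> ` S) = rk S))"

text \<open>Tagging the elements of the \<open>i\<close>-th block with \<open>i\<close> makes the blocks disjoint; the projection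
  onto the index set is then \<^const>\<open>fst\<close>.\<close>

definition tilde_block :: "('i set \<Rightarrow> nat) \<Rightarrow> 'i \<Rightarrow> ('i \<times> nat) set" where
  "tilde_block rk i = {i} \<times> {1..rk {i}}"

definition tilde_ground :: "'i set \<Rightarrow> ('i set \<Rightarrow> nat) \<Rightarrow> ('i \<times> nat) set" where
  "tilde_ground E rk = (\<Union>i\<in>E. tilde_block rk i)"

definition tilde_rank :: "'i set \<Rightarrow> ('i set \<Rightarrow> nat) \<Rightarrow> ('i \<times> nat) set \<Rightarrow> nat" where
  "tilde_rank E rk S =
     Min {rk A + card (S - {x \<in> tilde_ground E rk. fst x \<in> A}) |A. A \<subseteq> E}"

end

theory Submission
  imports Defs
begin

text \<open>
  The heart of uniqueness: let \<open>S\<close> be a subset of a multisymmetric matroid, \<open>A\<close> the set of blocks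
  contained in the closure of \<open>S\<close>, and \<open>T\<close> the union of \<open>S\<close> with these blocks. An element
  \<open>x \<in> S\<close> of any other block is a coloop of the restriction to \<open>T\<close>: otherwise \<open>T - {x}\<close> and \<open>S\<close>
  have the same closure \<open>G\<close>, which misses some \<open>y\<close> in the block of \<open>x\<close>, and swapping \<open>x\<close> and \<open>y\<close>
  turns \<open>G\<close> into a flat that contains \<open>T - {x}\<close> but not \<open>x\<close>. Hence
  \<open>rk S = rk T = rk (\<Union>i\<in>A. B i) + \<bar>S - (\<Union>i\<in>A. B i)\<bar>\<close>, so the rank function is given by the
  minimum formula and is determined by the polymatroid and the block sizes.
\<close>

section \<open>Closure in a polymatroid\<close>

text \<open>The closure operator: for a polymatroid and \<open>S \<subseteq> E\<close> this is the
  smallest flat containing \<open>S\<close>, by \<open>flat_rank_closure\<close> and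
  \<open>rank_closure_minimal\<close>.\<close>

definition rank_closure :: "'a set \<Rightarrow> ('a set \<Rightarrow> nat) \<Rightarrow> 'a set \<Rightarrow> 'a set" where
  "rank_closure E rk S = {x \<in> E. rk (insert x S) = rk S}"

lemma polymatroid_finite: "polymatroid E rk \<Longrightarrow> finite E"
  and polymatroid_empty: "polymatroid E rk \<Longrightarrow> rk {} = 0"
  and polymatroid_mono: "polymatroid E rk \<Longrightarrow> A \<subseteq> B \<Longrightarrow> B \<subseteq> E \<Longrightarrow> rk A \<le> rk B"
  and polymatroid_submodular:
    "polymatroid E rk \<Longrightarrow> A \<subseteq> E \<Longrightarrow> B \<subseteq> E \<Longrightarrow> rk (A \<union> B) + rk (A \<inter> B) \<le> rk A + rk B"
  unfolding polymatroid_def by blast+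

lemma polymatroid_subadditive:
  assumes "polymatroid E rk" "A \<subseteq> E" "B \<subseteq> E"
  shows "rk (A \<union> B) \<le> rk A + rk B"
  using polymatroid_submodular[OF assms] by linarith

lemma polymatroid_le_sum:
  assumes "polymatroid E rk" "A \<subseteq> E"
  shows "rk A \<le> (\<Sum>i\<in>A. rk {i})"
proof -
  have "finite A"
    using assms polymatroid_finite finite_subset by blast
  then show ?thesis
    using assms(2)
  proof (induction A rule: finite_induct)
    case empty
    then show ?case
      using polymatroid_empty[OF assms(1)] by simp
  next
    case (insert x F)
    have "rk (insert x F) \<le> rk {x} + rk F"
      using polymatroid_subadditive[OF assms(1), of "{x}" F] insert.prems by simp
    also have "\<dots> \<le> rk {x} + (\<Sum>i\<in>F. rk {i})"
      using insert by simp
    finally show ?case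
      using insert.hyps by simp
  qed
qed

lemma rank_closure_subset: "rank_closure E rk S \<subseteq> E"
  unfolding rank_closure_def by blast

lemma subset_rank_closure: "S \<subseteq> E \<Longrightarrow> S \<subseteq> rank_closure E rk S"
  unfolding rank_closure_def by (auto simp: insert_absorb)

text \<open>Elements that add no rank one at a time add none together: by submodularity the
  increment of \<open>x\<close> over \<open>S \<union> F\<close> is at most its increment over
  \<open>S\<close>, which is zero.\<close>

lemma rank_union_closure:
  assumes P: "polymatroid E rk" and S: "S \<subseteq> E" and C: "C \<subseteq> rank_closure E rk S"
  shows "rk (S \<union> C) = rk S"
proof -
  have "finite C"
    using C rank_closure_subset polymatroid_finite[OF P] by (metis finite_subset)
  then show ?thesis
    using C
  proof (induction C rule: finite_induct)
    case empty
    then show ?case by simp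
  next
    case (insert x F)
    have x: "x \<in> E" "rk (insert x S) = rk S"
      using insert.prems by (auto simp: rank_closure_def)
    have sub: "S \<union> F \<subseteq> E"
      using insert.prems S rank_closure_subset[of E rk S] by blast
    have "rk ((S \<union> F) \<union> insert x S) + rk ((S \<union> F) \<inter> insert x S) \<le> rk (S \<union> F) + rk (insert x S)"
      by (rule polymatroid_submodular[OF P]) (use sub x S in auto)
    moreover have "rk S \<le> rk ((S \<union> F) \<inter> insert x S)" "rk (S \<union> F) \<le> rk (S \<union> insert x F)"
      by (rule polymatroid_mono[OF P]; use sub x in blast)+
    moreover have "(S \<union> F) \<union> insert x S = S \<union> insert x F"
      by blast
    ultimately show ?case
      using insert x by simp
  qed
qed

lemma rank_rank_closure:
  assumes "polymatroid E rk" "S \<subseteq> E"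
  shows "rk (rank_closure E rk S) = rk S"
  using rank_union_closure[OF assms subset_refl] subset_rank_closure[OF assms(2)]
  by (simp add: Un_absorb1)

lemma flat_rank_closure:
  assumes P: "polymatroid E rk" and S: "S \<subseteq> E"
  shows "flat E rk (rank_closure E rk S)"
  unfolding flat_def
proof (intro conjI allI impI rank_closure_subset)
  fix G
  assume G: "rank_closure E rk S \<subseteq> G \<and> G \<subseteq> E \<and> rk G = rk (rank_closure E rk S)"
  have SG: "S \<subseteq> G"
    using G subset_rank_closure[OF S] by blast
  have "x \<in> rank_closure E rk S" if "x \<in> G" for x
  proof -
    have "rk S \<le> rk (insert x S)" "rk (insert x S) \<le> rk G"
      by (rule polymatroid_mono[OF P]; use that SG G in blast)+
    then show ?thesis
      using G that rank_rank_closure[OF P S] by (auto simp: rank_closure_def)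
  qed
  then show "G = rank_closure E rk S"
    using G by blast
qed

text \<open>Increments shrink as sets grow, so an element that adds no rank to \<open>S\<close> adds
  none to \<open>F\<close>; maximality of \<open>F\<close> then forces it into
  \<open>F\<close>.\<close>

lemma rank_closure_minimal:
  assumes P: "polymatroid E rk" and F: "flat E rk F" and SF: "S \<subseteq> F"
  shows "rank_closure E rk S \<subseteq> F"
proof
  fix x
  assume "x \<in> rank_closure E rk S"
  then have x: "x \<in> E" "rk (insert x S) = rk S"
    by (auto simp: rank_closure_def)
  have FE: "F \<subseteq> E"
    using F by (simp add: flat_def)
  have "rk (F \<union> insert x S) + rk (F \<inter> insert x S) \<le> rk F + rk (insert x S)"
    by (rule polymatroid_submodular[OF P]) (use FE SF x in auto)
  moreover have "rk S \<le> rk (F \<inter> insert x S)" "rk F \<le> rk (insert x F)"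
    by (rule polymatroid_mono[OF P]; use FE SF x in blast)+
  moreover have "F \<union> insert x S = insert x F"
    using SF by blast
  ultimately have "rk (insert x F) = rk F"
    using x by simp
  then have "insert x F = F"
    using F FE x unfolding flat_def by blast
  then show "x \<in> F"
    by blast
qed

text \<open>Coloops stay coloops while others are deleted, so each deletion costs at least one unit
  of rank. This is submodularity for \<open>T - F\<close> and \<open>T - {x}\<close>, whose union is
  \<open>T\<close>.\<close>

lemma rank_diff_coloops:
  assumes P: "polymatroid E rk" and T: "T \<subseteq> E" and X: "X \<subseteq> T"
    and coloop: "\<And>x. x \<in> X \<Longrightarrow> rk (T - {x}) < rk T"
  shows "rk (T - X) + card X \<le> rk T"
proof -
  have "finite X"
    using X T polymatroid_finite[OF P] by (meson finite_subset)
  then show ?thesis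
    using X coloop
  proof (induction X rule: finite_induct)
    case empty
    then show ?case by simp
  next
    case (insert x F)
    have "rk ((T - F) \<union> (T - {x})) + rk ((T - F) \<inter> (T - {x})) \<le> rk (T - F) + rk (T - {x})"
      by (rule polymatroid_submodular[OF P]) (use T in auto)
    moreover have "(T - F) \<union> (T - {x}) = T" "(T - F) \<inter> (T - {x}) = T - insert x F"
      using insert by auto
    moreover have "rk (T - {x}) < rk T"
      using insert.prems by simp
    moreover have "rk (T - F) + card F \<le> rk T"
      using insert by simp
    ultimately show ?case
      using insert.hyps by simp
  qed
qed

lemma flat_image:
  assumes \<sigma>: "\<sigma> permutes E" and inv: "\<And>S. S \<subseteq> E \<Longrightarrow> rk (\<sigma> ` S) = rk S" and F: "flat E rk F"
  shows "flat E rk (\<sigma> ` F)"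
  unfolding flat_def
proof (intro conjI allI impI)
  have FE: "F \<subseteq> E"
    using F by (simp add: flat_def)
  then show "\<sigma> ` F \<subseteq> E"
    using permutes_image[OF \<sigma>] by blast
  fix G
  assume G: "\<sigma> ` F \<subseteq> G \<and> G \<subseteq> E \<and> rk G = rk (\<sigma> ` F)"
  then obtain H where H: "H \<subseteq> E" "G = \<sigma> ` H"
    using permutes_image[OF \<sigma>] by (metis subset_imageE)
  have "F \<subseteq> H"
    using G H by (simp add: inj_image_subset_iff[OF permutes_inj[OF \<sigma>]])
  moreover have "rk H = rk F"
    using G H inv FE by metis
  ultimately have "H = F"
    using F H unfolding flat_def by blast
  then show "G = \<sigma> ` F"
    using H by simp
qed

section \<open>The canonical lift\<close>

lemma polymatroid_finite_rank_candidates: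
  assumes "polymatroid E rk"
  shows "finite {rk A + card (S - f A) |A. A \<subseteq> E}"
  using polymatroid_finite[OF assms] by simp

lemma tilde_rank_le:
  assumes "polymatroid E rk" "A \<subseteq> E"
  shows "tilde_rank E rk S \<le> rk A + card (S - {x \<in> tilde_ground E rk. fst x \<in> A})"
  unfolding tilde_rank_def
  by (rule Min_le) (use assms polymatroid_finite_rank_candidates[OF assms(1)] in auto)

lemma tilde_rank_attained:
  assumes "polymatroid E rk"
  obtains A where "A \<subseteq> E"
    and "tilde_rank E rk S = rk A + card (S - {x \<in> tilde_ground E rk. fst x \<in> A})"
proof -
  have "tilde_rank E rk S \<in> {rk A + card (S - {x \<in> tilde_ground E rk. fst x \<in> A}) |A. A \<subseteq> E}"
    unfolding tilde_rank_def
    by (rule Min_in) (use polymatroid_finite_rank_candidates[OF assms] in auto)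
  then show ?thesis
    using that by blast
qed

lemma finite_tilde_ground: "finite E \<Longrightarrow> finite (tilde_ground E rk)"
  unfolding tilde_ground_def tilde_block_def by simp

lemma tilde_ground_fibre:
  "A \<subseteq> E \<Longrightarrow> {x \<in> tilde_ground E rk. fst x \<in> A} = (\<Union>i\<in>A. tilde_block rk i)"
  unfolding tilde_ground_def tilde_block_def by auto

lemma card_tilde_block: "card (tilde_block rk i) = rk {i}"
  unfolding tilde_block_def by (simp add: card_cartesian_product)

lemma card_Union_tilde_block:
  "finite A \<Longrightarrow> card (\<Union>i\<in>A. tilde_block rk i) = (\<Sum>i\<in>A. rk {i})"
  by (subst card_UN_disjoint) (auto simp: card_tilde_block, auto simp: tilde_block_def)

section \<open>Matroid axioms for the minimum formula\<close>

text \<open>Cardinality is modular, and both the union and the intersection of the two sets on the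
  left lie in the union and the intersection of \<open>S - U\<close> and
  \<open>T - V\<close>.\<close>

lemma card_union_inter_diff_le:
  assumes "finite S" "finite T"
  shows "card ((S \<union> T) - (U \<union> V)) + card ((S \<inter> T) - (U \<inter> V)) \<le> card (S - U) + card (T - V)"
proof -
  let ?X = "(S \<union> T) - (U \<union> V)" and ?Y = "(S \<inter> T) - (U \<inter> V)"
  have "card ?X + card ?Y = card (?X \<union> ?Y) + card (?X \<inter> ?Y)"
    using assms by (intro card_Un_Int) auto
  also have "\<dots> \<le> card ((S - U) \<union> (T - V)) + card ((S - U) \<inter> (T - V))"
    using assms by (intro add_mono card_mono) auto
  also have "\<dots> = card (S - U) + card (T - V)"
    using assms by (intro card_Un_Int[symmetric]) auto
  finally show ?thesis .
qed

text \<open>If \<open>A\<close> and \<open>B\<close> are minimisers for \<open>S\<close> and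
  \<open>T\<close>, then \<open>A \<union> B\<close> and \<open>A \<inter> B\<close> are candidates
  for \<open>S \<union> T\<close> and \<open>S \<inter> T\<close>; the rank term and the cardinality
  term are each submodular.\<close>

lemma tilde_rank_submodular:
  assumes P: "polymatroid E rk" and "finite S" "finite T"
  shows "tilde_rank E rk (S \<union> T) + tilde_rank E rk (S \<inter> T) \<le> tilde_rank E rk S + tilde_rank E rk T"
proof -
  let ?\<pi> = "\<lambda>A. {x \<in> tilde_ground E rk. fst x \<in> A}"
  obtain A where A: "A \<subseteq> E" "tilde_rank E rk S = rk A + card (S - ?\<pi> A)"
    using tilde_rank_attained[OF P] .
  obtain B where B: "B \<subseteq> E" "tilde_rank E rk T = rk B + card (T - ?\<pi> B)"
    using tilde_rank_attained[OF P] .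
  have "tilde_rank E rk (S \<union> T) \<le> rk (A \<union> B) + card ((S \<union> T) - (?\<pi> A \<union> ?\<pi> B))"
  proof -
    have "?\<pi> (A \<union> B) = ?\<pi> A \<union> ?\<pi> B"
      by auto
    then show ?thesis
      using tilde_rank_le[OF P, of "A \<union> B" "S \<union> T"] A B by (metis Un_least)
  qed
  moreover have "?\<pi> (A \<inter> B) = ?\<pi> A \<inter> ?\<pi> B"
    by auto
  then have "tilde_rank E rk (S \<inter> T) \<le> rk (A \<inter> B) + card ((S \<inter> T) - (?\<pi> A \<inter> ?\<pi> B))"
    using tilde_rank_le[OF P, of "A \<inter> B" "S \<inter> T"] A B by (metis le_infI1)
  moreover have "rk (A \<union> B) + rk (A \<inter> B) \<le> rk A + rk B"
    using polymatroid_submodular[OF P] A B by blast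
  ultimately show ?thesis
    using card_union_inter_diff_le[OF assms(2,3), of "?\<pi> A" "?\<pi> B"] A B by linarith
qed

lemma tilde_rank_le_card:
  assumes "polymatroid E rk"
  shows "tilde_rank E rk S \<le> card S"
  using tilde_rank_le[OF assms, of "{}" S] polymatroid_empty[OF assms] by simp

lemma tilde_rank_mono:
  assumes P: "polymatroid E rk" and "S \<subseteq> T" "finite T"
  shows "tilde_rank E rk S \<le> tilde_rank E rk T"
proof -
  obtain A where A: "A \<subseteq> E"
    "tilde_rank E rk T = rk A + card (T - {x \<in> tilde_ground E rk. fst x \<in> A})"
    using tilde_rank_attained[OF P] .
  have "tilde_rank E rk S \<le> rk A + card (S - {x \<in> tilde_ground E rk. fst x \<in> A})"
    using tilde_rank_le[OF P A(1)] .
  also have "\<dots> \<le> tilde_rank E rk T"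
    unfolding A(2) using assms by (intro add_left_mono card_mono) auto
  finally show ?thesis .
qed

lemma matroid_tilde:
  assumes P: "polymatroid E rk"
  shows "matroid (tilde_ground E rk) (tilde_rank E rk)"
proof -
  have fin: "finite S" if "S \<subseteq> tilde_ground E rk" for S
    using that finite_tilde_ground[OF polymatroid_finite[OF P]] by (rule finite_subset)
  have "tilde_rank E rk {} = 0"
    using tilde_rank_le_card[OF P, of "{}"] by simp
  then have "polymatroid (tilde_ground E rk) (tilde_rank E rk)"
    unfolding polymatroid_def
    using fin tilde_rank_mono[OF P] tilde_rank_submodular[OF P] by simp
  then show ?thesis
    unfolding matroid_def using tilde_rank_le_card[OF P] by simp
qed

lemma loopless_tilde:
  assumes P: "polymatroid E rk" and L: "loopless E rk"
  shows "loopless (tilde_ground E rk) (tilde_rank E rk)"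
  unfolding loopless_def
proof (intro allI impI)
  fix S
  assume S: "S \<subseteq> tilde_ground E rk \<and> S \<noteq> {}"
  then have "finite S"
    using finite_tilde_ground[OF polymatroid_finite[OF P]] finite_subset by blast
  obtain A where A: "A \<subseteq> E"
    "tilde_rank E rk S = rk A + card (S - {x \<in> tilde_ground E rk. fst x \<in> A})"
    using tilde_rank_attained[OF P] .
  \<comment> \<open>A nonempty minimiser \<open>A\<close> has positive rank; for
    \<open>A = {}\<close> the value is \<open>card S\<close>.\<close>
  show "tilde_rank E rk S > 0"
    using A S L \<open>finite S\<close> by (cases "A = {}") (auto simp: loopless_def card_gt_0_iff)
qed

section \<open>Restriction to unions of blocks, and block symmetry\<close>

text \<open>The candidate \<open>A\<close> itself gives the value \<open>rk A\<close>. Any other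
  candidate \<open>C\<close> pays the full rank \<open>rk {i}\<close> for each block with
  \<open>i \<in> A - C\<close>, which by subadditivity is at least what \<open>rk\<close> gains from
  \<open>C\<close> to \<open>C \<union> A\<close>.\<close>

lemma tilde_rank_Union_block:
  assumes P: "polymatroid E rk" and A: "A \<subseteq> E"
  shows "tilde_rank E rk (\<Union>i\<in>A. tilde_block rk i) = rk A"
proof (rule antisym)
  show "tilde_rank E rk (\<Union>i\<in>A. tilde_block rk i) \<le> rk A"
    using tilde_rank_le[OF P A, of "\<Union>i\<in>A. tilde_block rk i"] by (simp add: tilde_ground_fibre[OF A])
  obtain C where C: "C \<subseteq> E" "tilde_rank E rk (\<Union>i\<in>A. tilde_block rk i) =
      rk C + card ((\<Union>i\<in>A. tilde_block rk i) - {x \<in> tilde_ground E rk. fst x \<in> C})"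
    using tilde_rank_attained[OF P] .
  have "(\<Union>i\<in>A. tilde_block rk i) - {x \<in> tilde_ground E rk. fst x \<in> C} =
      (\<Union>i\<in>A - C. tilde_block rk i)"
    unfolding tilde_ground_fibre[OF C(1)] by (auto simp: tilde_block_def)
  moreover have "finite (A - C)"
    using A polymatroid_finite[OF P] by (meson finite_Diff finite_subset)
  ultimately have eq: "tilde_rank E rk (\<Union>i\<in>A. tilde_block rk i) = rk C + (\<Sum>i\<in>A - C. rk {i})"
    using C(2) card_Union_tilde_block by metis
  have "rk A \<le> rk (C \<union> (A - C))"
    by (rule polymatroid_mono[OF P]) (use A C in auto)
  also have "\<dots> \<le> rk C + rk (A - C)"
    by (rule polymatroid_subadditive[OF P]) (use A C in auto)
  also have "\<dots> \<le> rk C + (\<Sum>i\<in>A - C. rk {i})"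
    using polymatroid_le_sum[OF P, of "A - C"] A by auto
  finally show "rk A \<le> tilde_rank E rk (\<Union>i\<in>A. tilde_block rk i)"
    using eq by simp
qed

text \<open>A block permutation maps the fibre over each \<open>A\<close> onto itself, so every
  candidate in the minimum keeps its value.\<close>

lemma tilde_rank_block_permutation:
  assumes \<sigma>: "\<sigma> \<in> block_permutations (tilde_ground E rk) E (tilde_block rk)"
  shows "tilde_rank E rk (\<sigma> ` S) = tilde_rank E rk S"
proof -
  have inj: "inj \<sigma>"
    using \<sigma> permutes_inj unfolding block_permutations_def by blast
  have "card (\<sigma> ` S - {x \<in> tilde_ground E rk. fst x \<in> A}) =
      card (S - {x \<in> tilde_ground E rk. fst x \<in> A})" if A: "A \<subseteq> E" for A
  proof -
    have "\<sigma> ` (\<Union>i\<in>A. tilde_block rk i) = (\<Union>i\<in>A. tilde_block rk i)"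
      using \<sigma> A unfolding block_permutations_def image_UN by (intro SUP_cong) auto
    then have "\<sigma> ` S - (\<Union>i\<in>A. tilde_block rk i) = \<sigma> ` (S - (\<Union>i\<in>A. tilde_block rk i))"
      using image_set_diff[OF inj] by metis
    then show ?thesis
      unfolding tilde_ground_fibre[OF A] using inj by (simp add: card_image inj_on_subset)
  qed
  then have "{rk A + card (\<sigma> ` S - {x \<in> tilde_ground E rk. fst x \<in> A}) |A. A \<subseteq> E} =
      {rk A + card (S - {x \<in> tilde_ground E rk. fst x \<in> A}) |A. A \<subseteq> E}"
    by (intro Collect_cong ex_cong1) auto
  then show ?thesis
    unfolding tilde_rank_def by simp
qed

lemma minimal_multisymmetric_lift_tilde:
  assumes P: "polymatroid E rk" and L: "loopless E rk"
  shows "minimal_multisymmetric_lift E rk (tilde_ground E rk) (tilde_rank E rk) (tilde_block rk)"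
proof -
  have "disjoint_family_on (tilde_block rk) E"
    unfolding disjoint_family_on_def tilde_block_def by auto
  moreover have "tilde_block rk i \<noteq> {}" if "i \<in> E" for i
  proof -
    have "rk {i} > 0"
      using L that unfolding loopless_def by blast
    then show ?thesis
      unfolding tilde_block_def by auto
  qed
  moreover have "flat (tilde_ground E rk) (tilde_rank E rk) (\<sigma> ` F)"
    if "\<sigma> \<in> block_permutations (tilde_ground E rk) E (tilde_block rk)"
      "flat (tilde_ground E rk) (tilde_rank E rk) F" for \<sigma> F
    using that tilde_rank_block_permutation[OF that(1)]
    by (intro flat_image) (auto simp: block_permutations_def)
  ultimately have "multisymmetric_matroid (tilde_ground E rk) (tilde_rank E rk) E (tilde_block rk)"
    unfolding multisymmetric_matroid_def
    using matroid_tilde[OF P] loopless_tilde[OF P L] by (auto simp: tilde_ground_def)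
  moreover have "tilde_rank E rk (tilde_block rk i) = card (tilde_block rk i)" if "i \<in> E" for i
    using tilde_rank_Union_block[OF P, of "{i}"] that by (simp add: card_tilde_block)
  ultimately show ?thesis
    unfolding minimal_multisymmetric_lift_def multisymmetric_lift_def
    using tilde_rank_Union_block[OF P] by simp
qed

section \<open>Uniqueness\<close>

text \<open>By disjointness each block contains both of \<open>x\<close> and \<open>y\<close> or
  neither. These swaps are the only symmetries that the uniqueness argument uses.\<close>

lemma transpose_mem_block_permutations:
  assumes "disjoint_family_on B I" "(\<Union>i\<in>I. B i) = E" "i \<in> I" "x \<in> B i" "y \<in> B i"
  shows "transpose x y \<in> block_permutations E I B"
proof -
  have "x \<in> B j \<longleftrightarrow> y \<in> B j" if "j \<in> I" for j
    using assms that unfolding disjoint_family_on_def disjoint_iff by metis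
  then have "transpose x y ` B j = B j" if "j \<in> I" for j
    using that transpose_image_eq by metis
  moreover have "transpose x y permutes E"
    using assms by (intro permutes_swap_id) auto
  ultimately show ?thesis
    unfolding block_permutations_def by blast
qed

section \<open>The minimum formula in a multisymmetric matroid\<close>

text \<open>The upper bound in the minimum formula; with \<open>U\<close> a union of blocks it
  bounds \<open>rk S\<close> by every candidate.\<close>

lemma matroid_rank_le:
  assumes M: "matroid E rk" and "S \<subseteq> E" "U \<subseteq> E"
  shows "rk S \<le> rk U + card (S - U)"
proof -
  have P: "polymatroid E rk"
    using M by (simp add: matroid_def)
  have "rk S \<le> rk (U \<union> (S - U))"
    by (rule polymatroid_mono[OF P]) (use assms in auto)
  also have "\<dots> \<le> rk U + rk (S - U)"
    by (rule polymatroid_subadditive[OF P]) (use assms in auto)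
  also have "\<dots> \<le> rk U + card (S - U)"
    using assms unfolding matroid_def by (meson Diff_subset add_left_mono order_trans)
  finally show ?thesis .
qed

text \<open>The matching lower bound: some union of blocks attains the minimum. Only here does
  invariance of flats enter the uniqueness proof.\<close>

lemma multisymmetric_matroid_rank_attained:
  assumes M: "multisymmetric_matroid E rk I B" and S: "S \<subseteq> E"
  obtains A where "A \<subseteq> I" and "rk (\<Union>i\<in>A. B i) + card (S - (\<Union>i\<in>A. B i)) \<le> rk S"
proof
  define A where "A = {i \<in> I. B i \<subseteq> rank_closure E rk S}"
  define U where "U = (\<Union>i\<in>A. B i)"
  define T where "T = S \<union> U"
  have P: "polymatroid E rk" and disj: "disjoint_family_on B I" and UN: "(\<Union>i\<in>I. B i) = E"
    using M unfolding multisymmetric_matroid_def matroid_def by auto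
  show "A \<subseteq> I"
    unfolding A_def by blast
  have U: "U \<subseteq> rank_closure E rk S"
    unfolding U_def A_def by blast
  then have T: "T \<subseteq> rank_closure E rk S" "T \<subseteq> E"
    using subset_rank_closure[OF S] rank_closure_subset[of E rk S] S unfolding T_def by blast+
  have rT: "rk T = rk S"
    unfolding T_def by (rule rank_union_closure[OF P S U])
  have "rk (T - {x}) < rk T" if x: "x \<in> S - U" for x
  proof (rule ccontr)
    assume "\<not> rk (T - {x}) < rk T"
    moreover have "rk (T - {x}) \<le> rk T"
      by (rule polymatroid_mono[OF P]) (use T in auto)
    ultimately have rTx: "rk (T - {x}) = rk T"
      by simp
    define G where "G = rank_closure E rk (T - {x})"
    have xT: "x \<in> T"
      using x T_def by blast
    \<comment> \<open>Putting \<open>x\<close> back into \<open>T - {x}\<close> gives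
      \<open>T\<close>, which has the same rank.\<close>
    then have xG: "x \<in> G"
      using rTx T unfolding G_def rank_closure_def by (auto simp: insert_absorb)
    obtain i where i: "i \<in> I" "x \<in> B i"
      using x S UN by blast
    have "i \<notin> A"
      using x i unfolding U_def by blast
    \<comment> \<open>Only blocks inside the closure of \<open>S\<close> are indexed by
      \<open>A\<close>, so the block of \<open>x\<close> sticks out of it.\<close>
    then obtain y where y: "y \<in> B i" "y \<notin> rank_closure E rk S"
      using i unfolding A_def by blast
    have G: "flat E rk G"
      unfolding G_def using flat_rank_closure[OF P] T by blast
    have TG: "T \<subseteq> G"
      using xG subset_rank_closure[of "T - {x}" E rk] T unfolding G_def by blast
    have "G \<subseteq> rank_closure E rk S"
      unfolding G_def using rank_closure_minimal[OF P flat_rank_closure[OF P S]] T by blast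
    then have yG: "y \<notin> G"
      using y by blast
    have "flat E rk (transpose x y ` G)"
      using M G transpose_mem_block_permutations[OF disj UN i y(1)]
      unfolding multisymmetric_matroid_def by blast
    \<comment> \<open>The swap fixes \<open>T - {x}\<close> pointwise, since \<open>y\<close> lies
      outside \<open>G\<close> and hence outside \<open>T\<close>.\<close>
    moreover have "T - {x} \<subseteq> transpose x y ` G"
    proof
      fix z
      assume z: "z \<in> T - {x}"
      then have "transpose x y z = z"
        using yG TG by (intro transpose_apply_other) auto
      then show "z \<in> transpose x y ` G"
        using z TG by (metis DiffD1 imageI subsetD)
    qed
    ultimately have "G \<subseteq> transpose x y ` G"
      unfolding G_def using rank_closure_minimal[OF P] by blast
    \<comment> \<open>\<open>G\<close> is the least flat above \<open>T - {x}\<close>, so the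
      swapped flat contains \<open>x\<close>. The only preimage of \<open>x\<close> is
      \<open>y\<close>, which is not in \<open>G\<close>.\<close>
    then obtain z where "z \<in> G" "x = transpose x y z"
      using xG by blast
    then have "z = y"
      by (metis transpose_apply_first transpose_involutory)
    then show False
      using \<open>z \<in> G\<close> yG by blast
  qed
  \<comment> \<open>Deleting all these coloops from \<open>T\<close> leaves exactly
    \<open>U\<close>.\<close>
  moreover have "S - U \<subseteq> T" "T - (S - U) = U"
    unfolding T_def by auto
  ultimately have "rk U + card (S - U) \<le> rk T"
    using rank_diff_coloops[OF P T(2), of "S - U"] by simp
  then show "rk (\<Union>i\<in>A. B i) + card (S - (\<Union>i\<in>A. B i)) \<le> rk S"
    using rT unfolding U_def by simp
qed

text \<open>Minimality fixes the block sizes, so bijections chosen block by block glue to one of the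
  ground sets. It preserves rank because the same minimum formula computes both ranks.\<close>

lemma minimal_multisymmetric_lift_unique:
  assumes P: "polymatroid I rk" and min: "minimal_multisymmetric_lift I rk M rkM B"
  shows "lift_isomorphic I (tilde_ground I rk) (tilde_rank I rk) (tilde_block rk) M rkM B"
proof -
  have MS: "multisymmetric_matroid M rkM I B"
    and lift: "\<And>A. A \<subseteq> I \<Longrightarrow> rk A = rkM (\<Union>i\<in>A. B i)"
    and rB: "\<And>i. i \<in> I \<Longrightarrow> rkM (B i) = card (B i)"
    using min unfolding minimal_multisymmetric_lift_def multisymmetric_lift_def by auto
  then have mat: "matroid M rkM" and disj: "disjoint_family_on B I" and UN: "(\<Union>i\<in>I. B i) = M"
    unfolding multisymmetric_matroid_def by auto
  have finM: "finite M"
    using mat polymatroid_finite unfolding matroid_def by blast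
  have "\<exists>h. bij_betw h (tilde_block rk i) (B i)" if "i \<in> I" for i
  proof (rule finite_same_card_bij)
    show "finite (tilde_block rk i)"
      by (simp add: tilde_block_def)
    show "finite (B i)"
      by (rule finite_subset[OF _ finM]) (use that UN in blast)
    \<comment> \<open>Both sizes equal \<open>rkM (B i)\<close>: the left by the lift condition at
      \<open>{i}\<close>, the right by minimality.\<close>
    show "card (tilde_block rk i) = card (B i)"
      using lift[of "{i}"] rB[of i] that by (simp add: card_tilde_block)
  qed
  then obtain h where h: "\<And>i. i \<in> I \<Longrightarrow> bij_betw (h i) (tilde_block rk i) (B i)"
    by metis
  \<comment> \<open>The tag \<open>fst x\<close> selects the bijection that belongs to the block of
    \<open>x\<close>.\<close>
  define \<phi> where "\<phi> x = h (fst x) x" for x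
  have \<phi>: "bij_betw \<phi> (tilde_block rk i) (B i)" if "i \<in> I" for i
    using h[OF that] by (rule iffD1[OF bij_betw_cong, rotated]) (auto simp: \<phi>_def tilde_block_def)
  then have image: "\<phi> ` tilde_block rk i = B i" if "i \<in> I" for i
    using that by (simp add: bij_betw_def)
  have "bij_betw \<phi> (\<Union>i\<in>I. tilde_block rk i) (\<Union>i\<in>I. B i)"
    by (rule bij_betw_UNION_disjoint[OF disj \<phi>])
  then have bij: "bij_betw \<phi> (tilde_ground I rk) M"
    unfolding UN tilde_ground_def .
  have "rkM (\<phi> ` S) = tilde_rank I rk S" if S: "S \<subseteq> tilde_ground I rk" for S
  proof -
    have \<phi>S: "\<phi> ` S \<subseteq> M"
      using S bij by (auto simp: bij_betw_def)
    \<comment> \<open>This matches the candidates of the two minimum formulas term by term, indexed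
      by the same \<open>A\<close>.\<close>
    have card: "card (\<phi> ` S - (\<Union>i\<in>A. B i)) = card (S - {x \<in> tilde_ground I rk. fst x \<in> A})"
      if A: "A \<subseteq> I" for A
    proof -
      have sub: "(\<Union>i\<in>A. tilde_block rk i) \<subseteq> tilde_ground I rk"
        using A by (auto simp: tilde_ground_def)
      have "(\<Union>i\<in>A. B i) = \<phi> ` (\<Union>i\<in>A. tilde_block rk i)"
        using image A unfolding image_UN by (intro SUP_cong) auto
      then have "\<phi> ` S - (\<Union>i\<in>A. B i) = \<phi> ` (S - (\<Union>i\<in>A. tilde_block rk i))"
        using inj_on_image_set_diff[OF bij_betw_imp_inj_on[OF bij], of S] S sub
        by (metis Diff_subset order_trans)
      moreover have "inj_on \<phi> (S - (\<Union>i\<in>A. tilde_block rk i))"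
        using bij_betw_imp_inj_on[OF bij] by (rule inj_on_subset) (use S in blast)
      ultimately show ?thesis
        by (simp add: tilde_ground_fibre[OF A] card_image)
    qed
    show ?thesis
    proof (rule antisym)
      obtain A where A: "A \<subseteq> I"
        "tilde_rank I rk S = rk A + card (S - {x \<in> tilde_ground I rk. fst x \<in> A})"
        using tilde_rank_attained[OF P] .
      have "rkM (\<phi> ` S) \<le> rkM (\<Union>i\<in>A. B i) + card (\<phi> ` S - (\<Union>i\<in>A. B i))"
        by (rule matroid_rank_le[OF mat \<phi>S]) (use A UN in blast)
      then show "rkM (\<phi> ` S) \<le> tilde_rank I rk S"
        using A lift card by simp
    next
      obtain A where A: "A \<subseteq> I"
        "rkM (\<Union>i\<in>A. B i) + card (\<phi> ` S - (\<Union>i\<in>A. B i)) \<le> rkM (\<phi> ` S)"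
        using multisymmetric_matroid_rank_attained[OF MS \<phi>S] .
      then show "tilde_rank I rk S \<le> rkM (\<phi> ` S)"
        using tilde_rank_le[OF P A(1), of S] lift[OF A(1)] card[OF A(1)] by simp
    qed
  qed
  then show ?thesis
    unfolding lift_isomorphic_def using bij image by blast
qed

text \<open>The type variable \<open>'b\<close> is free, so uniqueness covers lifts whose ground
  sets live in any type.\<close>

theorem theorem2p9:
  fixes n :: nat and rk :: "nat set \<Rightarrow> nat"
  assumes "polymatroid {1..n} rk" and "loopless {1..n} rk"
  shows "minimal_multisymmetric_lift {1..n} rk
           (tilde_ground {1..n} rk) (tilde_rank {1..n} rk) (tilde_block rk) \<and>
         (\<forall>(M :: 'b set) rkM B.
            minimal_multisymmetric_lift {1..n} rk M rkM B \<longrightarrow>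
            lift_isomorphic {1..n}
              (tilde_ground {1..n} rk) (tilde_rank {1..n} rk) (tilde_block rk) M rkM B)"
  using minimal_multisymmetric_lift_tilde[OF assms] minimal_multisymmetric_lift_unique[OF assms(1)]
  by blast

end
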